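(* Let $M$ be a partially ordered monoid with a family of null sequences $N(M)$, let $(X,d_{X,M})$ be a complete $FM$-distance space, and let $f\colon X\to X$ satisfy: whenever $x,a\in X$ and $f^n(x)\to a$ as $n\to\infty$, then $f(a)=a$. Let $\lambda\colon M_+\to M_+$ be non-decreasing (i.e. $x\le y$ implies $\lambda(x)\le\lambda(y)$). (i) Assume $x_0\in X$ is such that for the sequence $x_n=f(x_{n-1})$, $n\in\mathbb{N}$, one has $$d_{X,M}(x_n,x_{n+1})\leq\lambda(d_{X,M}(x_{n-1},x_n))\quad\text{for all } n\in\mathbb{N},$$ and $\sum_{n=1}^\infty\lambda^n(d_{X,M}(x_0,x_1))$ is a Cauchy series. Then $f$ has a fixed point, which is the limit of the sequence $\{x_n\}$. (ii) If, instead of the two conditions in (i), the stronger conditions $$d_{X,M}(f(x),f(y))\leq\lambda(d_{X,M}(x,y))\quad\text{for all } x,y\in X$$ and "$\sum_{n=1}^\infty\lambda^n(\alpha)$ is a Cauchy series for every $\alpha\in M_+$" hold, then $f$ has a unique fixed point.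
   Context: A monoid $M$ is a set with an associative binary operation $+$ (not assumed commutative) and a two-sided neutral element $\theta_M$. A partially ordered monoid is a monoid $M$ with a partial order $\le$ (reflexive, transitive, antisymmetric) such that $M_+:=\{x\in M:\theta_M\le x\}\neq\{\theta_M\}$ and $x_1\le y_1$, $x_2\le y_2$ imply $x_1+x_2\le y_1+y_2$. A family of null sequences $N(M)$ is a family of sequences in $M_+$ such that: (1) the constant sequence $\{\theta_M\}$ is in $N(M)$, and if a constant sequence $\{x,x,\ldots\}$, $x\in M_+$, is in $N(M)$ then $x=\theta_M$; (2) $\{x_n\},\{y_n\}\in N(M)$ implies $\{x_n+y_n\}\in N(M)$; (3) $\{x_n\}\in N(M)$ and $\theta_M\le y_n\le x_n$ for all $n\in\mathbb{N}$ imply $\{y_n\}\in N(M)$; (4) substitution, addition or removal of finitely many elements of a sequence of $N(M)$ (elements of $M_+$) preserves membership in $N(M)$; (5) each subsequence of a sequence of $N(M)$ is in $N(M)$. A family $N(M)$ is fixed. "Increasing" sequences of natural numbers are strictly increasing. $f^n$ and $\lambda^n$ denote $n$-fold iterates. For $\{x_n\}\subset M_+$, the series $\sum_{n=1}^\infty x_n$ is a Cauchy series if for all increasing sequences of natural numbers $\{n_k\},\{m_k\}$ with $m_k\ge n_k$ for all $k$ one has $\{\sum_{s=n_k}^{m_k}x_s\}_k\in N(M)$. An $M$-valued distance on a set $X$ is a map $d_{X,M}\colon X\times X\to M_+$ with $d_{X,M}(x,y)=d_{X,M}(y,x)$ and $d_{X,M}(x,y)=\theta_M\iff x=y$. Then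 $(X,d_{X,M})$ is an $M$-distance space. A sequence $\{x_n\}\subset X$ converges to $x\in X$ ($x_n\to x$) if $\{d_{X,M}(x_n,x)\}\in N(M)$; it is a Cauchy sequence if $\{d_{X,M}(x_{n_k},x_{m_k})\}_k\in N(M)$ for all increasing sequences of natural numbers $\{n_k\},\{m_k\}$ with $m_k>n_k$ for all $k$. $(X,d_{X,M})$ is an $FM$-distance space ($FM$-space) if it has the strong Fréchet–Wilson property: for every sequence $\{x_n\}\subset X$ and all increasing sequences of natural numbers $\{n_k\},\{m_k\}$ with $m_k>n_k$ for all $k$, $\{\sum_{s=n_k}^{m_k-1}d_{X,M}(x_s,x_{s+1})\}_k\in N(M)$ implies $\{d_{X,M}(x_{n_k},x_{m_k})\}_k\in N(M)$. It is complete if each Cauchy sequence converges to an element of $X$. *)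

theory Defs
  imports Main "HOL-Library.FuncSet"
begin

text \<open>
  The monoid need not be commutative, so the library's ordered additive classes (which all
  extend \<^class>\<open>ab_semigroup_add\<close>) do not apply. For the same reason finite sums
  \<open>x\<^sub>n + \<dots> + x\<^sub>m\<close> are taken in order, with \<^const>\<open>sum_list\<close>.
  The set \<open>M\<^sub>+\<close> is \<open>{0..}\<close>.
\<close>

class po_monoid = monoid_add + order +
  assumes po_add_mono: "x1 \<le> y1 \<Longrightarrow> x2 \<le> y2 \<Longrightarrow> x1 + x2 \<le> y1 + y2"
    and po_nontrivial: "{0..} \<noteq> {0}"

text \<open>
  All sequences are indexed from 0. A strictly increasing \<open>r\<close> with cofinite range describes
  the passage from \<open>y\<close> to \<open>y \<circ> r\<close> by removing finitely many terms, and from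
  \<open>y \<circ> r\<close> to \<open>y\<close> by inserting finitely many terms.
\<close>

locale null_family =
  fixes N :: "(nat \<Rightarrow> 'm::po_monoid) set"
  assumes null_nonneg: "x \<in> N \<Longrightarrow> 0 \<le> x n"
    and null_zero: "(\<lambda>_. 0) \<in> N"
    and null_const: "(\<lambda>_. c) \<in> N \<Longrightarrow> c = 0"
    and null_add: "x \<in> N \<Longrightarrow> y \<in> N \<Longrightarrow> (\<lambda>n. x n + y n) \<in> N"
    and null_le: "x \<in> N \<Longrightarrow> (\<And>n. 0 \<le> y n \<and> y n \<le> x n) \<Longrightarrow> y \<in> N"
    and null_substitute:
      "x \<in> N \<Longrightarrow> (\<And>n. 0 \<le> y n) \<Longrightarrow> finite {n. y n \<noteq> x n} \<Longrightarrow> y \<in> N"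
    and null_insert:
      "strict_mono r \<Longrightarrow> finite (- range r) \<Longrightarrow> (\<And>n. 0 \<le> y n) \<Longrightarrow> y \<circ> r \<in> N \<Longrightarrow> y \<in> N"
    and null_remove:
      "strict_mono r \<Longrightarrow> finite (- range r) \<Longrightarrow> y \<in> N \<Longrightarrow> y \<circ> r \<in> N"
    and null_subseq: "strict_mono r \<Longrightarrow> x \<in> N \<Longrightarrow> x \<circ> r \<in> N"

definition cauchy_series :: "(nat \<Rightarrow> 'm::po_monoid) set \<Rightarrow> (nat \<Rightarrow> 'm) \<Rightarrow> bool" where
  "cauchy_series N x \<longleftrightarrow>
     (\<forall>n m. strict_mono n \<and> strict_mono m \<and> (\<forall>k. n k \<le> m k) \<longrightarrow>
        (\<lambda>k. \<Sum>s\<leftarrow>[n k..<Suc (m k)]. x s) \<in> N)"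

definition converges_to ::
  "(nat \<Rightarrow> 'm::po_monoid) set \<Rightarrow> ('x \<Rightarrow> 'x \<Rightarrow> 'm) \<Rightarrow> (nat \<Rightarrow> 'x) \<Rightarrow> 'x \<Rightarrow> bool" where
  "converges_to N d x a \<longleftrightarrow> (\<lambda>n. d (x n) a) \<in> N"

definition cauchy_seq ::
  "(nat \<Rightarrow> 'm::po_monoid) set \<Rightarrow> ('x \<Rightarrow> 'x \<Rightarrow> 'm) \<Rightarrow> (nat \<Rightarrow> 'x) \<Rightarrow> bool" where
  "cauchy_seq N d x \<longleftrightarrow>
     (\<forall>n m. strict_mono n \<and> strict_mono m \<and> (\<forall>k. n k < m k) \<longrightarrow>
        (\<lambda>k. d (x (n k)) (x (m k))) \<in> N)"

locale M_distance =
  fixes d :: "'x \<Rightarrow> 'x \<Rightarrow> 'm::po_monoid"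
  assumes dist_nonneg: "0 \<le> d x y"
    and dist_sym: "d x y = d y x"
    and dist_eq_zero: "d x y = 0 \<longleftrightarrow> x = y"

text \<open>The additional axiom is the strong Frechet--Wilson property.\<close>

locale FM_space = null_family N + M_distance d
  for N :: "(nat \<Rightarrow> 'm::po_monoid) set" and d :: "'x \<Rightarrow> 'x \<Rightarrow> 'm" +
  assumes strong_Frechet_Wilson:
    "strict_mono n \<Longrightarrow> strict_mono m \<Longrightarrow> (\<And>k. n k < m k) \<Longrightarrow>
     (\<lambda>k. \<Sum>s\<leftarrow>[n k..<m k]. d (x s) (x (Suc s))) \<in> N \<Longrightarrow>
     (\<lambda>k. d (x (n k)) (x (m k))) \<in> N"

locale complete_FM_space = FM_space N d
  for N :: "(nat \<Rightarrow> 'm::po_monoid) set" and d :: "'x \<Rightarrow> 'x \<Rightarrow> 'm" +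
  assumes complete: "cauchy_seq N d x \<Longrightarrow> \<exists>a. converges_to N d x a"

end

theory Submission
  imports Defs
begin

text \<open>
  Iterating the contraction condition bounds \<open>d (x n) (x (n + 1))\<close> by \<open>\<lambda>\<^sup>n\<close> of the first step,
  so the Cauchy series and the strong Frechet--Wilson property make the orbit a Cauchy sequence;
  its limit is fixed by hypothesis. Two fixed points have a distance lying below every
  \<open>\<lambda>\<^sup>n\<close> of itself, which is a null sequence.
\<close>

lemma sum_list_mono_po:
  fixes g h :: "'a \<Rightarrow> 'm::po_monoid"
  assumes "\<And>i. i \<in> set xs \<Longrightarrow> g i \<le> h i"
  shows "(\<Sum>i\<leftarrow>xs. g i) \<le> (\<Sum>i\<leftarrow>xs. h i)"
  using assms by (induction xs) (auto intro: po_add_mono)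

lemma sum_list_nonneg_po:
  fixes g :: "'a \<Rightarrow> 'm::po_monoid"
  assumes "\<And>i. i \<in> set xs \<Longrightarrow> 0 \<le> g i"
  shows "0 \<le> (\<Sum>i\<leftarrow>xs. g i)"
  using sum_list_mono_po[of xs "\<lambda>_. 0" g] assms by simp

lemma funpow_closed:
  assumes "lam \<in> A \<rightarrow> A" and "x \<in> A"
  shows "(lam ^^ n) x \<in> A"
  using assms by (induction n) auto

text \<open>Induction on \<open>n\<close>, applying \<open>lam\<close> to both sides. Since
  \<open>lam\<close> is monotone only on \<open>A\<close>, the iterates must first be known to stay
  in \<open>A\<close>. Applied below to the step distances of an orbit and to a constant
  sequence.\<close>

lemma funpow_dominates:
  fixes u :: "nat \<Rightarrow> 'm::order"
  assumes "lam \<in> A \<rightarrow> A" and "mono_on A lam" and "\<And>n. u n \<in> A"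
    and step: "\<And>n. u (Suc n) \<le> lam (u n)"
  shows "u n \<le> (lam ^^ n) (u 0)"
proof (induction n)
  case (Suc n)
  have "(lam ^^ n) (u 0) \<in> A"
    using assms by (intro funpow_closed)
  then have "lam (u n) \<le> lam ((lam ^^ n) (u 0))"
    using Suc assms by (intro mono_onD[of A lam])
  then show ?case
    using step[of n] by simp
qed simp

text \<open>Blocks of length one: the Cauchy condition admits equal endpoints, so
  \<open>n k = m k = k\<close> recovers the terms themselves.\<close>

lemma (in null_family) cauchy_series_null:
  assumes "cauchy_series N x"
  shows "x \<in> N"
proof -
  have "(\<lambda>k. \<Sum>s\<leftarrow>[k..<Suc k]. x s) \<in> N"
    using assms[unfolded cauchy_series_def, rule_format, of "\<lambda>k. k" "\<lambda>k. k"]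
    by (simp add: strict_mono_def)
  then show ?thesis
    by simp
qed

context FM_space
begin

text \<open>Apply the strong Frechet--Wilson property to \<open>a, x 0, b, a, x 1, b, \<dots>\<close>
  and the blocks from \<open>a\<close> to \<open>b\<close>.\<close>

lemma limit_unique:
  assumes "converges_to N d x a" and "converges_to N d x b"
  shows "a = b"
proof -
  define z where "z i = (if i mod 3 = 0 then a else if i mod 3 = 1 then x (i div 3) else b)" for i
  have z: "z (3 * k) = a" "z (Suc (3 * k)) = x k" "z (Suc (Suc (3 * k))) = b" for k
  proof -
    have "Suc (3 * k) mod 3 = 1" "Suc (3 * k) div 3 = k" "Suc (Suc (3 * k)) mod 3 = 2"
      by presburger+
    then show "z (3 * k) = a" "z (Suc (3 * k)) = x k" "z (Suc (Suc (3 * k))) = b"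
      by (simp_all add: z_def)
  qed
  \<comment> \<open>The summands stand in the order of the block, since addition need not
    commute.\<close>
  have "(\<lambda>k. d a (x k) + d (x k) b) \<in> N"
    using null_add assms by (simp add: converges_to_def dist_sym)
  then have "(\<lambda>k. \<Sum>s\<leftarrow>[3 * k..<Suc (Suc (3 * k))]. d (z s) (z (Suc s))) \<in> N"
    by (simp add: z)
  then have "(\<lambda>k. d (z (3 * k)) (z (Suc (Suc (3 * k))))) \<in> N"
    by (intro strong_Frechet_Wilson) (auto simp: strict_mono_def)
  then have "(\<lambda>_. d a b) \<in> N"
    by (simp add: z)
  then show ?thesis
    using null_const dist_eq_zero by blast
qed

text \<open>Prepending one term is an insertion along \<open>Suc\<close>, whose range misses only
  0.\<close>

lemma converges_to_shift:
  assumes "converges_to N d (\<lambda>n. x (Suc n)) a"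
  shows "converges_to N d x a"
proof -
  have "- range Suc = {0}"
    by (auto simp: image_iff) (metis not0_implies_Suc)
  then have "finite (- range Suc)"
    by simp
  moreover have "0 \<le> d (x n) a" for n
    by (rule dist_nonneg)
  moreover have "(\<lambda>n. d (x n) a) \<circ> Suc \<in> N"
    using assms by (simp add: converges_to_def comp_def)
  ultimately show ?thesis
    unfolding converges_to_def
    by (rule null_insert[rotated]) (simp_all add: strict_mono_def dist_nonneg)
qed

text \<open>Block sums of the step distances are squeezed between 0 and block sums of
  \<open>u\<close>, hence null; the strong Frechet--Wilson property then passes to the distances of
  the block ends.\<close>

lemma cauchy_seq_if_dominated:
  assumes series: "cauchy_series N u" and le: "\<And>n. d (x n) (x (Suc n)) \<le> u n"
  shows "cauchy_seq N d x"
  unfolding cauchy_seq_def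
proof (intro allI impI, elim conjE)
  fix n m :: "nat \<Rightarrow> nat"
  assume n: "strict_mono n" and m: "strict_mono m" and less: "\<forall>k. n k < m k"
  \<comment> \<open>Blocks of a Cauchy series include their right end, while the Frechet--Wilson
    sums stop before \<open>m k\<close>. So the series is used with right ends
    \<open>m k - 1\<close>; no truncation occurs because \<open>m k\<close> exceeds
    \<open>n k\<close>.\<close>
  have Suc_pred: "Suc (m k - 1) = m k" for k
    using less[rule_format, of k] by simp
  have "strict_mono (\<lambda>k. m k - 1)"
    using m Suc_pred unfolding strict_mono_def by (metis Suc_less_eq)
  moreover have "n k \<le> m k - 1" for k
    using less[rule_format, of k] by simp
  ultimately have "(\<lambda>k. \<Sum>s\<leftarrow>[n k..<Suc (m k - 1)]. u s) \<in> N"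
    using series n unfolding cauchy_series_def by blast
  then have "(\<lambda>k. \<Sum>s\<leftarrow>[n k..<m k]. u s) \<in> N"
    unfolding Suc_pred .
  then have "(\<lambda>k. \<Sum>s\<leftarrow>[n k..<m k]. d (x s) (x (Suc s))) \<in> N"
    by (rule null_le) (auto intro!: sum_list_nonneg_po sum_list_mono_po dist_nonneg le)
  then show "(\<lambda>k. d (x (n k)) (x (m k))) \<in> N"
    using n m less by (intro strong_Frechet_Wilson) auto
qed

lemma fixed_point_unique:
  assumes "lam \<in> {0..} \<rightarrow> {0..}" and "mono_on {0..} lam"
    and contr: "\<And>x y. d (f x) (f y) \<le> lam (d x y)"
    and series: "\<And>\<alpha>. 0 \<le> \<alpha> \<Longrightarrow> cauchy_series N (\<lambda>n. (lam ^^ Suc n) \<alpha>)"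
    and "f a = a" and "f b = b"
  shows "a = b"
proof -
  have "d a b \<le> lam (d a b)"
    using contr[of a b] assms by simp
  \<comment> \<open>The constant sequence \<open>d a b\<close> satisfies the step condition of
    \<open>funpow_dominates\<close>.\<close>
  then have "d a b \<le> (lam ^^ n) (d a b)" for n
    using funpow_dominates[of lam "{0..}" "\<lambda>_. d a b"] assms dist_nonneg by simp
  then have le: "0 \<le> d a b \<and> d a b \<le> (lam ^^ Suc n) (d a b)" for n
    using dist_nonneg by blast
  have "(\<lambda>n. (lam ^^ Suc n) (d a b)) \<in> N"
    using cauchy_series_null[OF series[OF dist_nonneg]] .
  then have "(\<lambda>_. d a b) \<in> N"
    using le by (rule null_le)
  then show ?thesis
    using null_const dist_eq_zero by blast
qed

end

text \<open>The series starts with \<open>\<lambda>\<^sup>1\<close>, which bounds the second step, so the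
  argument is run for the shifted orbit.\<close>

lemma (in complete_FM_space) iteration_converges:
  assumes "lam \<in> {0..} \<rightarrow> {0..}" and "mono_on {0..} lam"
    and "\<And>n. d (x (Suc n)) (x (Suc (Suc n))) \<le> lam (d (x n) (x (Suc n)))"
    and series: "cauchy_series N (\<lambda>n. (lam ^^ Suc n) (d (x 0) (x 1)))"
  obtains a where "converges_to N d x a"
proof -
  have "d (x n) (x (Suc n)) \<le> (lam ^^ n) (d (x 0) (x 1))" for n
    using funpow_dominates[of lam "{0..}" "\<lambda>n. d (x n) (x (Suc n))" n] assms dist_nonneg
    by simp
  then have "cauchy_seq N d (\<lambda>n. x (Suc n))"
    by (intro cauchy_seq_if_dominated[OF series])
  then show ?thesis
    using complete converges_to_shift that by blast
qed

theorem theorem2: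
  fixes N :: "(nat \<Rightarrow> 'm::po_monoid) set"
    and d :: "'x \<Rightarrow> 'x \<Rightarrow> 'm"
    and f :: "'x \<Rightarrow> 'x"
    and lam :: "'m \<Rightarrow> 'm"
  assumes "complete_FM_space N d"
    and "\<And>x a. converges_to N d (\<lambda>n. (f ^^ n) x) a \<Longrightarrow> f a = a"
    and "lam \<in> {0..} \<rightarrow> {0..}"
    and "mono_on {0..} lam"
  shows "(\<forall>x. (\<forall>n. x (Suc n) = f (x n)) \<longrightarrow>
              (\<forall>n. d (x (Suc n)) (x (Suc (Suc n))) \<le> lam (d (x n) (x (Suc n)))) \<longrightarrow>
              cauchy_series N (\<lambda>n. (lam ^^ Suc n) (d (x 0) (x 1))) \<longrightarrow>
              (\<exists>a. f a = a \<and> converges_to N d x a \<and> (\<forall>b. converges_to N d x b \<longrightarrow> b = a)))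
       \<and> ((\<forall>x y. d (f x) (f y) \<le> lam (d x y)) \<longrightarrow>
          (\<forall>\<alpha>\<ge>0. cauchy_series N (\<lambda>n. (lam ^^ Suc n) \<alpha>)) \<longrightarrow>
          (\<exists>!a. f a = a))"
proof -
  interpret complete_FM_space N d by fact
  have lim: "\<exists>a. f a = a \<and> converges_to N d x a \<and> (\<forall>b. converges_to N d x b \<longrightarrow> b = a)"
    if orbit: "\<And>n. x (Suc n) = f (x n)"
      and contr: "\<And>n. d (x (Suc n)) (x (Suc (Suc n))) \<le> lam (d (x n) (x (Suc n)))"
      and series: "cauchy_series N (\<lambda>n. (lam ^^ Suc n) (d (x 0) (x 1)))"
    for x
  proof -
    obtain a where a: "converges_to N d x a"
      using iteration_converges[OF assms(3,4) contr series] .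
    \<comment> \<open>The hypothesis on \<open>f\<close> speaks of iterates, so the recursive orbit
      is rewritten as one.\<close>
    have "(f ^^ n) (x 0) = x n" for n
      by (induction n) (simp_all add: orbit)
    then have "converges_to N d (\<lambda>n. (f ^^ n) (x 0)) a"
      using a by simp
    then show ?thesis
      using a assms(2) limit_unique by blast
  qed
  have "\<exists>!a. f a = a"
    if contr: "\<And>x y. d (f x) (f y) \<le> lam (d x y)"
      and series: "\<And>\<alpha>. 0 \<le> \<alpha> \<Longrightarrow> cauchy_series N (\<lambda>n. (lam ^^ Suc n) \<alpha>)"
  proof (rule ex_ex1I)
    \<comment> \<open>Types are nonempty, so the orbit of an arbitrary point is available; along it
      the global contraction yields the conditions of the first part.\<close>
    fix x0 :: 'x
    show "\<exists>a. f a = a"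
      using lim[of "\<lambda>n. (f ^^ n) x0"] contr series[OF dist_nonneg] by auto
  next
    show "a = b" if "f a = a" "f b = b" for a b
      using fixed_point_unique[OF assms(3,4) contr series that] .
  qed
  with lim show ?thesis
    by blast
qed

end
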